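(* Let $S$ be a reduced information semialgebra. The following statements are equivalent. (a) $U_n(S)$ is a BFM for every integer $n\ge 2$. (b) $U_n(S)$ is a BFM for some integer $n\ge 2$. (c) $(S,+)$ is a BFM.
   Context: All monoids are cancellative but not necessarily commutative. An information semialgebra is a semiring $S$ with $0$ and $1$ (so $(S,+)$ is a commutative monoid with identity $0$, multiplication has identity $1$ and distributes over addition, and $0\cdot x=0$ for all $x$) such that $(S,+)$ is a cancellative commutative monoid whose only invertible element is $0$, and $(S\setminus\{0\},\cdot)$ is a cancellative commutative monoid. $S$ is reduced if $1$ is the only invertible element of $(S\setminus\{0\},\cdot)$. $U_n(S)$ is the multiplicative monoid of $n\times n$ upper triangular matrices over $S$ all of whose diagonal entries equal $1$. In a monoid $M$, an atom is a non-invertible $a$ such that $a=uv$ implies that $u$ or $v$ is invertible; $M$ is atomic if each non-invertible element is a finite product of atoms. A length of a non-invertible $x$ is a number $\ell\ge1$ with $x=a_1\cdots a_\ell$ for atoms $a_i$; $\mathsf L(x)$ is the set of lengths of $x$, and $\mathsf L(u)=\{0\}$ for invertible $u$. $M$ is a BFM (bounded factorization monoid) if it is atomic and $\mathsf L(x)$ is finite for every $x\in M$. *)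

theory Defs
  imports "HOL-Algebra.Divisibility" "Jordan_Normal_Form.Matrix"
begin

text \<open>
  Atoms in a not necessarily commutative monoid. The predicate \<^const>\<open>irreducible\<close> is not used
  since it is phrased via one-sided (left) divisibility.
\<close>

definition monoid_atom :: "('a, 'm) monoid_scheme \<Rightarrow> 'a \<Rightarrow> bool" where
  "monoid_atom M a \<longleftrightarrow> a \<in> carrier M \<and> a \<notin> Units M \<and>
     (\<forall>u\<in>carrier M. \<forall>v\<in>carrier M. a = u \<otimes>\<^bsub>M\<^esub> v \<longrightarrow> u \<in> Units M \<or> v \<in> Units M)"

definition atom_factorization :: "('a, 'm) monoid_scheme \<Rightarrow> 'a list \<Rightarrow> 'a \<Rightarrow> bool" where
  "atom_factorization M as x \<longleftrightarrow>
     (\<forall>a\<in>set as. monoid_atom M a) \<and> foldr (\<otimes>\<^bsub>M\<^esub>) as \<one>\<^bsub>M\<^esub> = x"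

definition length_set :: "('a, 'm) monoid_scheme \<Rightarrow> 'a \<Rightarrow> nat set" where
  "length_set M x =
     (if x \<in> Units M then {0}
      else {l. l \<ge> 1 \<and> (\<exists>as. length as = l \<and> atom_factorization M as x)})"

text \<open>All monoids are cancellative by convention, so cancellativity is part of the next notions.\<close>

locale atomic_monoid = monoid_cancel M for M (structure) +
  assumes atomic: "x \<in> carrier M \<Longrightarrow> x \<notin> Units M \<Longrightarrow> \<exists>as. atom_factorization M as x"

locale bf_monoid = atomic_monoid M for M (structure) +
  assumes finite_length_set: "x \<in> carrier M \<Longrightarrow> finite (length_set M x)"

text \<open>
  The law \<open>x \<otimes> \<zero> = \<zero>\<close> contained in \<^locale>\<open>semiring\<close> is redundant here: it follows from right
  distributivity and additive cancellation. The last assumption entails that \<open>\<one> \<noteq> \<zero>\<close> and that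
  there are no zero divisors.
\<close>

locale information_semialgebra = semiring S for S (structure) +
  assumes add_cancel: "comm_monoid_cancel (add_monoid S)"
    and add_Units: "Units (add_monoid S) = {\<zero>}"
    and mult_cancel:
      "comm_monoid_cancel \<lparr>carrier = carrier S - {\<zero>}, mult = mult S, one = one S\<rparr>"

locale reduced_information_semialgebra = information_semialgebra S for S (structure) +
  assumes mult_Units:
    "Units \<lparr>carrier = carrier S - {\<zero>}, mult = mult S, one = one S\<rparr> = {\<one>}"

text \<open>
  The monoid \<open>U\<^sub>n(S)\<close>, with indices ranging over \<open>0, \<dots>, n - 1\<close>. The type of matrices is that of the
  library, but the entries are added and multiplied in the semiring \<open>S\<close>, whereas the matrix
  operations of the library use the type-class operations on the entries.
\<close>

definition unitriangular_monoid :: "('a, 'm) ring_scheme \<Rightarrow> nat \<Rightarrow> 'a mat monoid" where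
  "unitriangular_monoid S n =
     \<lparr>carrier = {A \<in> carrier_mat n n. elements_mat A \<subseteq> carrier S \<and>
                   (\<forall>i<n. \<forall>j<i. A $$ (i, j) = \<zero>\<^bsub>S\<^esub>) \<and> (\<forall>i<n. A $$ (i, i) = \<one>\<^bsub>S\<^esub>)},
      mult = (\<lambda>A B. mat n n (\<lambda>(i, j). \<Oplus>\<^bsub>S\<^esub>k\<in>{..<n}. A $$ (i, k) \<otimes>\<^bsub>S\<^esub> B $$ (k, j))),
      one = mat n n (\<lambda>(i, j). if i = j then \<one>\<^bsub>S\<^esub> else \<zero>\<^bsub>S\<^esub>)\<rparr>"

end

theory Submission
  imports Defs
begin

text \<open>
  A cancellative monoid whose only unit is the identity is a BFM iff it carries a superadditive
  function to the natural numbers that vanishes only at the identity; the maximal factorization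
  length is such a function. If \<open>f\<close> is one for \<open>(S, +)\<close>, then the sum of the values of \<open>f\<close> at the
  entries above the diagonal is one for \<open>U\<^sub>n(S)\<close>: for \<open>i < j\<close> the entry \<open>(A B)\<^sub>i\<^sub>j\<close> is \<open>A\<^sub>i\<^sub>j + B\<^sub>i\<^sub>j\<close> plus
  further terms. Conversely, a length function on \<open>U\<^sub>n(S)\<close> pulls back along the embedding of
  \<open>(S, +)\<close> that sends \<open>x\<close> to \<open>I + x E\<^sub>0\<^sub>1\<close>.
\<close>

section \<open>Length functions\<close>

text \<open>In a monoid the converse of the second clause is automatic:
  \<open>f \<one> + f \<one> \<le> f \<one>\<close> forces \<open>f \<one> = 0\<close>, and then
  \<open>f\<close> vanishes at every unit.\<close>

definition length_function :: "('a, 'm) monoid_scheme \<Rightarrow> ('a \<Rightarrow> nat) \<Rightarrow> bool" where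
  "length_function M f \<longleftrightarrow>
     (\<forall>x\<in>carrier M. \<forall>y\<in>carrier M. f x + f y \<le> f (x \<otimes>\<^bsub>M\<^esub> y)) \<and>
     (\<forall>x\<in>carrier M. f x = 0 \<longrightarrow> x \<in> Units M)"

lemma length_functionI:
  assumes "\<And>x y. x \<in> carrier M \<Longrightarrow> y \<in> carrier M \<Longrightarrow> f x + f y \<le> f (x \<otimes>\<^bsub>M\<^esub> y)"
    and "\<And>x. x \<in> carrier M \<Longrightarrow> f x = 0 \<Longrightarrow> x \<in> Units M"
  shows "length_function M f"
  using assms unfolding length_function_def by blast

lemma length_function_mult_le:
  "length_function M f \<Longrightarrow> x \<in> carrier M \<Longrightarrow> y \<in> carrier M \<Longrightarrow> f x + f y \<le> f (x \<otimes>\<^bsub>M\<^esub> y)"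
  unfolding length_function_def by blast

lemma length_function_eq_0_imp_Units:
  "length_function M f \<Longrightarrow> x \<in> carrier M \<Longrightarrow> f x = 0 \<Longrightarrow> x \<in> Units M"
  unfolding length_function_def by blast

section \<open>Products of lists and factorizations into atoms\<close>

lemma (in monoid) foldr_mult_closed:
  "set as \<subseteq> carrier G \<Longrightarrow> foldr (\<otimes>) as \<one> \<in> carrier G"
  by (induction as) auto

lemma (in monoid) foldr_mult_append:
  assumes "set as \<subseteq> carrier G" "set bs \<subseteq> carrier G"
  shows "foldr (\<otimes>) (as @ bs) \<one> = foldr (\<otimes>) as \<one> \<otimes> foldr (\<otimes>) bs \<one>"
  using assms by (induction as) (auto simp: foldr_mult_closed m_assoc)

lemma atom_factorization_subset_carrier:
  "atom_factorization M as x \<Longrightarrow> set as \<subseteq> carrier M"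
  unfolding atom_factorization_def monoid_atom_def by blast

lemma (in monoid) atom_factorization_append:
  assumes "atom_factorization G as x" "atom_factorization G bs y"
  shows "atom_factorization G (as @ bs) (x \<otimes> y)"
  using assms foldr_mult_append[OF assms[THEN atom_factorization_subset_carrier]]
  by (auto simp: atom_factorization_def)

text \<open>Atoms are non-units, so each factor contributes at least 1 to \<open>f x\<close>. The
  bound is the same for all factorizations of \<open>x\<close>.\<close>

lemma (in monoid) length_le_length_function:
  assumes f: "length_function G f" and "atom_factorization G as x"
  shows "length as \<le> f x"
  using assms(2)
proof (induction as arbitrary: x)
  case (Cons a as)
  let ?y = "foldr (\<otimes>) as \<one>"
  have as: "atom_factorization G as ?y" and x: "x = a \<otimes> ?y"
    and a: "a \<in> carrier G" "a \<notin> Units G"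
    using Cons.prems by (auto simp: atom_factorization_def monoid_atom_def)
  have "?y \<in> carrier G"
    using foldr_mult_closed[OF atom_factorization_subset_carrier[OF as]] .
  moreover have "f a > 0"
    using length_function_eq_0_imp_Units[OF f a(1)] a(2) by blast
  ultimately show ?case
    using Cons.IH[OF as] length_function_mult_le[OF f a(1), of ?y] x by simp
qed simp

text \<open>Induction on \<open>f x\<close>: a non-unit that is no atom splits into two non-units,
  both with positive and hence strictly smaller value.\<close>

lemma (in monoid) length_function_imp_atom_factorization:
  assumes f: "length_function G f" and "x \<in> carrier G" "x \<notin> Units G"
  shows "\<exists>as. atom_factorization G as x"
  using assms(2,3)
proof (induction "f x" arbitrary: x rule: less_induct)
  case less
  show ?case
  proof (cases "monoid_atom G x")
    case True
    then show ?thesis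
      using less.prems by (intro exI[of _ "[x]"]) (simp add: atom_factorization_def)
  next
    case False
    then obtain u v where uv: "u \<in> carrier G" "v \<in> carrier G" "x = u \<otimes> v"
      "u \<notin> Units G" "v \<notin> Units G"
      using less.prems unfolding monoid_atom_def by auto
    have "f u > 0" "f v > 0"
      using length_function_eq_0_imp_Units[OF f] uv by blast+
    with length_function_mult_le[OF f uv(1,2)] uv(3) have "f u < f x" "f v < f x"
      by auto
    then obtain as bs where "atom_factorization G as u" "atom_factorization G bs v"
      using less.hyps[of u] less.hyps[of v] uv by auto
    from atom_factorization_append[OF this] show ?thesis
      unfolding uv(3) by (rule exI)
  qed
qed

lemma (in monoid_cancel) length_function_imp_bf_monoid:
  assumes f: "length_function G f"
  shows "bf_monoid G"
proof unfold_locales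
  show "finite (length_set G x)" for x
  proof (rule finite_subset)
    show "length_set G x \<subseteq> {..f x}"
      using length_le_length_function[OF f] by (auto simp: length_set_def)
  qed simp
qed (use length_function_imp_atom_factorization[OF f] in blast)

text \<open>Concatenating longest factorizations of \<open>x\<close> and \<open>y\<close> gives a
  factorization of \<open>x \<otimes> y\<close>, so the maximal length is superadditive.\<close>

lemma (in bf_monoid) ex_length_function:
  assumes Units: "Units M = {\<one>}"
  shows "\<exists>f. length_function M f"
proof (intro exI length_functionI)
  let ?f = "\<lambda>x. Max (length_set M x)"
  have mem: "length as \<in> length_set M x"
    if "atom_factorization M as x" "x \<noteq> \<one>" for as x
  proof -
    have "as \<noteq> []"
      using that by (auto simp: atom_factorization_def)
    then have "length as \<ge> 1"
      by (simp add: Suc_le_eq)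
    with that show ?thesis
      unfolding length_set_def Units by auto
  qed
  have le: "length as \<le> ?f x"
    if "atom_factorization M as x" "x \<in> carrier M" "x \<noteq> \<one>" for as x
    using mem[OF that(1,3)] finite_length_set[OF that(2)] by simp
  have one: "?f \<one> = 0"
    by (simp add: length_set_def Units)
  \<comment> \<open>The maximum is attained: atomicity makes the length set nonempty, and it is
    finite.\<close>
  have Max: "\<exists>as. length as = ?f x \<and> atom_factorization M as x"
    if "x \<in> carrier M" "x \<noteq> \<one>" for x
  proof -
    have "length_set M x \<noteq> {}"
      using atomic[of x] mem[of _ x] that unfolding Units by blast
    then have "?f x \<in> length_set M x"
      using finite_length_set[OF that(1)] by simp
    then show ?thesis
      using that(2) unfolding length_set_def Units by simp
  qed
  show "x \<in> Units M" if "x \<in> carrier M" "?f x = 0" for x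
    using Max[of x] that unfolding Units by (auto simp: atom_factorization_def)
  show "?f x + ?f y \<le> ?f (x \<otimes> y)" if xy: "x \<in> carrier M" "y \<in> carrier M" for x y
  proof -
    consider "x = \<one>" | "y = \<one>" | "x \<noteq> \<one>" "y \<noteq> \<one>"
      by blast
    then show ?thesis
    proof cases
      case 3
      obtain as bs where as: "length as = ?f x" "atom_factorization M as x"
        and bs: "length bs = ?f y" "atom_factorization M bs y"
        using Max[OF xy(1) 3(1)] Max[OF xy(2) 3(2)] by blast
      \<comment> \<open>The bound \<open>le\<close> is available only away from the identity. By
        cancellation a one-sided inverse is two-sided, so \<open>x \<otimes> y = \<one>\<close>
        would make \<open>x\<close> a unit.\<close>
      have "x \<otimes> y \<noteq> \<one>"
      proof
        assume xy1: "x \<otimes> y = \<one>"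
        have "x \<otimes> (y \<otimes> x) = x \<otimes> \<one>"
          using xy xy1 by (simp flip: m_assoc)
        then have "y \<otimes> x = \<one>"
          using xy l_cancel[of x "y \<otimes> x" \<one>] by simp
        with xy1 xy have "x \<in> Units M"
          unfolding Units_def by blast
        with Units 3 show False by simp
      qed
      then show ?thesis
        using le[OF atom_factorization_append[OF as(2) bs(2)]] xy as(1) bs(1) by simp
    qed (use xy one in simp_all)
  qed
qed

section \<open>Unitriangular matrices\<close>

lemma carrier_unitriangular_iff:
  "A \<in> carrier (unitriangular_monoid S n) \<longleftrightarrow>
     A \<in> carrier_mat n n \<and> (\<forall>i<n. \<forall>j<n. A $$ (i, j) \<in> carrier S) \<and>
     (\<forall>i<n. \<forall>j<i. A $$ (i, j) = \<zero>\<^bsub>S\<^esub>) \<and> (\<forall>i<n. A $$ (i, i) = \<one>\<^bsub>S\<^esub>)"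
proof (cases "A \<in> carrier_mat n n")
  case True
  then have "elements_mat A \<subseteq> carrier S \<longleftrightarrow> (\<forall>i<n. \<forall>j<n. A $$ (i, j) \<in> carrier S)"
    by (auto dest!: elements_matD)
  with True show ?thesis
    by (simp add: unitriangular_monoid_def)
qed (simp add: unitriangular_monoid_def)

lemma unitriangularD:
  assumes "A \<in> carrier (unitriangular_monoid S n)"
  shows "dim_row A = n" "dim_col A = n"
    and "i < n \<Longrightarrow> j < n \<Longrightarrow> A $$ (i, j) \<in> carrier S"
    and "i < n \<Longrightarrow> j < i \<Longrightarrow> A $$ (i, j) = \<zero>\<^bsub>S\<^esub>"
    and "i < n \<Longrightarrow> A $$ (i, i) = \<one>\<^bsub>S\<^esub>"
  using assms unfolding carrier_unitriangular_iff by auto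

lemma unitriangular_mult_index:
  assumes "i < n" "j < n"
  shows "(A \<otimes>\<^bsub>unitriangular_monoid S n\<^esub> B) $$ (i, j) =
    (\<Oplus>\<^bsub>S\<^esub>k\<in>{..<n}. A $$ (i, k) \<otimes>\<^bsub>S\<^esub> B $$ (k, j))"
  using assms by (simp add: unitriangular_monoid_def)

lemma unitriangular_mult_dim:
  "dim_row (A \<otimes>\<^bsub>unitriangular_monoid S n\<^esub> B) = n"
  "dim_col (A \<otimes>\<^bsub>unitriangular_monoid S n\<^esub> B) = n"
  by (simp_all add: unitriangular_monoid_def)

lemma unitriangular_one_index:
  assumes "i < n" "j < n"
  shows "\<one>\<^bsub>unitriangular_monoid S n\<^esub> $$ (i, j) = (if i = j then \<one>\<^bsub>S\<^esub> else \<zero>\<^bsub>S\<^esub>)"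
  using assms by (simp add: unitriangular_monoid_def)

lemma unitriangular_one_dim:
  "dim_row \<one>\<^bsub>unitriangular_monoid S n\<^esub> = n" "dim_col \<one>\<^bsub>unitriangular_monoid S n\<^esub> = n"
  by (simp_all add: unitriangular_monoid_def)

section \<open>Isolating one term of a finite sum\<close>

lemma (in abelian_monoid) finsum_remove:
  assumes "finite A" "a \<in> A" "f \<in> A \<rightarrow> carrier G"
  shows "finsum G f A = f a \<oplus> finsum G f (A - {a})"
proof -
  have "f \<in> A - {a} \<rightarrow> carrier G" "f a \<in> carrier G"
    using assms by auto
  with add.finprod_insert[of "A - {a}" a f] assms show ?thesis
    by (simp add: insert_absorb)
qed

lemma (in abelian_monoid) finsum_single:
  assumes "finite A" "a \<in> A" "f a \<in> carrier G" "\<And>k. k \<in> A \<Longrightarrow> k \<noteq> a \<Longrightarrow> f k = \<zero>"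
  shows "finsum G f A = f a"
proof -
  have "f \<in> A \<rightarrow> carrier G"
    using assms by (metis Pi_I zero_closed)
  moreover have "finsum G f (A - {a}) = \<zero>"
    using assms(4) by (intro add.finprod_one_eqI) auto
  ultimately show ?thesis
    using assms by (simp add: finsum_remove)
qed

text \<open>Closure follows from the triangular shape: below the diagonal every term of the product
  entry has a zero factor, and on the diagonal only one term survives. Associativity is an
  interchange of two finite sums.\<close>

lemma (in semiring) unitriangular_monoid: "monoid (unitriangular_monoid R n)"
proof (rule monoidI)
  let ?U = "unitriangular_monoid R n"
  fix A B assume A: "A \<in> carrier ?U" and B: "B \<in> carrier ?U"
  note AB = unitriangularD[OF A] unitriangularD[OF B]
  have lower: "(\<Oplus>k\<in>{..<n}. A $$ (i, k) \<otimes> B $$ (k, j)) = \<zero>" if "i < n" "j < i" for i j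
  proof (rule add.finprod_one_eqI)
    fix k assume "k \<in> {..<n}"
    \<comment> \<open>For \<open>k < i\<close> the left factor vanishes; otherwise
      \<open>j < i \<le> k\<close> and the right one does.\<close>
    with that show "A $$ (i, k) \<otimes> B $$ (k, j) = \<zero>"
      by (cases "k < i") (simp_all add: AB)
  qed
  have diag: "(\<Oplus>k\<in>{..<n}. A $$ (i, k) \<otimes> B $$ (k, i)) = \<one>" if "i < n" for i
  proof -
    have "(\<Oplus>k\<in>{..<n}. A $$ (i, k) \<otimes> B $$ (k, i)) = A $$ (i, i) \<otimes> B $$ (i, i)"
    proof (rule finsum_single)
      fix k assume "k \<in> {..<n}" "k \<noteq> i"
      with that show "A $$ (i, k) \<otimes> B $$ (k, i) = \<zero>"
        by (cases "k < i") (simp_all add: AB)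
    qed (use that in \<open>simp_all add: AB\<close>)
    with that show ?thesis by (simp add: AB)
  qed
  show "A \<otimes>\<^bsub>?U\<^esub> B \<in> carrier ?U"
    unfolding carrier_unitriangular_iff
    by (auto simp: unitriangular_mult_index lower diag AB intro!: finsum_closed
        carrier_matI unitriangular_mult_dim)
next
  let ?U = "unitriangular_monoid R n"
  show "\<one>\<^bsub>?U\<^esub> \<in> carrier ?U"
    unfolding carrier_unitriangular_iff
    by (auto simp: unitriangular_one_index intro!: carrier_matI unitriangular_one_dim)
next
  let ?U = "unitriangular_monoid R n"
  fix A B C assume A: "A \<in> carrier ?U" and B: "B \<in> carrier ?U" and C: "C \<in> carrier ?U"
  note ABC = unitriangularD[OF A] unitriangularD[OF B] unitriangularD[OF C]
  show "A \<otimes>\<^bsub>?U\<^esub> B \<otimes>\<^bsub>?U\<^esub> C = A \<otimes>\<^bsub>?U\<^esub> (B \<otimes>\<^bsub>?U\<^esub> C)"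
  proof (rule eq_matI)
    fix i j assume "i < dim_row (A \<otimes>\<^bsub>?U\<^esub> (B \<otimes>\<^bsub>?U\<^esub> C))" "j < dim_col (A \<otimes>\<^bsub>?U\<^esub> (B \<otimes>\<^bsub>?U\<^esub> C))"
    then have ij: "i < n" "j < n"
      by (simp_all add: unitriangular_mult_dim)
    have "(A \<otimes>\<^bsub>?U\<^esub> B \<otimes>\<^bsub>?U\<^esub> C) $$ (i, j) =
        (\<Oplus>k\<in>{..<n}. (A \<otimes>\<^bsub>?U\<^esub> B) $$ (i, k) \<otimes> C $$ (k, j))"
      using ij by (rule unitriangular_mult_index)
    also have "\<dots> = (\<Oplus>k\<in>{..<n}. \<Oplus>l\<in>{..<n}. A $$ (i, l) \<otimes> (B $$ (l, k) \<otimes> C $$ (k, j)))"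
      using ij
      by (intro finsum_cong')
        (auto simp: unitriangular_mult_index ABC finsum_ldistr m_assoc
          intro!: finsum_closed finsum_cong')
    also have "\<dots> = (\<Oplus>l\<in>{..<n}. \<Oplus>k\<in>{..<n}. A $$ (i, l) \<otimes> (B $$ (l, k) \<otimes> C $$ (k, j)))"
      using ij by (intro finsum_finsum_swap) (auto simp: ABC)
    also have "\<dots> = (\<Oplus>l\<in>{..<n}. A $$ (i, l) \<otimes> (B \<otimes>\<^bsub>?U\<^esub> C) $$ (l, j))"
      using ij
      by (intro finsum_cong')
        (auto simp: unitriangular_mult_index ABC finsum_rdistr intro!: finsum_closed)
    also have "\<dots> = (A \<otimes>\<^bsub>?U\<^esub> (B \<otimes>\<^bsub>?U\<^esub> C)) $$ (i, j)"
      using ij by (rule unitriangular_mult_index[symmetric])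
    finally show "(A \<otimes>\<^bsub>?U\<^esub> B \<otimes>\<^bsub>?U\<^esub> C) $$ (i, j) = (A \<otimes>\<^bsub>?U\<^esub> (B \<otimes>\<^bsub>?U\<^esub> C)) $$ (i, j)" .
  qed (simp_all add: unitriangular_mult_dim)
next
  let ?U = "unitriangular_monoid R n"
  fix A assume A: "A \<in> carrier ?U"
  note A = unitriangularD[OF A]
  show "\<one>\<^bsub>?U\<^esub> \<otimes>\<^bsub>?U\<^esub> A = A"
  proof (rule eq_matI)
    fix i j assume "i < dim_row A" "j < dim_col A"
    then have ij: "i < n" "j < n" by (simp_all add: A)
    have "(\<Oplus>k\<in>{..<n}. \<one>\<^bsub>?U\<^esub> $$ (i, k) \<otimes> A $$ (k, j)) = \<one>\<^bsub>?U\<^esub> $$ (i, i) \<otimes> A $$ (i, j)"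
      using ij by (intro finsum_single) (auto simp: unitriangular_one_index A)
    with ij show "(\<one>\<^bsub>?U\<^esub> \<otimes>\<^bsub>?U\<^esub> A) $$ (i, j) = A $$ (i, j)"
      by (simp add: unitriangular_mult_index unitriangular_one_index A)
  qed (simp_all add: unitriangular_mult_dim A)
  show "A \<otimes>\<^bsub>?U\<^esub> \<one>\<^bsub>?U\<^esub> = A"
  proof (rule eq_matI)
    fix i j assume "i < dim_row A" "j < dim_col A"
    then have ij: "i < n" "j < n" by (simp_all add: A)
    have "(\<Oplus>k\<in>{..<n}. A $$ (i, k) \<otimes> \<one>\<^bsub>?U\<^esub> $$ (k, j)) = A $$ (i, j) \<otimes> \<one>\<^bsub>?U\<^esub> $$ (j, j)"
      using ij by (intro finsum_single) (auto simp: unitriangular_one_index A)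
    with ij show "(A \<otimes>\<^bsub>?U\<^esub> \<one>\<^bsub>?U\<^esub>) $$ (i, j) = A $$ (i, j)"
      by (simp add: unitriangular_mult_index unitriangular_one_index A)
  qed (simp_all add: unitriangular_mult_dim A)
qed

section \<open>Cancellation and units in \<open>S\<close> and in U_n(S)\<close>

context information_semialgebra
begin

lemma add_r_cancel:
  "a \<oplus> c = b \<oplus> c \<Longrightarrow> a \<in> carrier S \<Longrightarrow> b \<in> carrier S \<Longrightarrow> c \<in> carrier S \<Longrightarrow> a = b"
  using monoid_cancel.r_cancel[OF comm_monoid_cancel.axioms(1)[OF add_cancel], of a c b] by simp

lemma add_eq_zeroD:
  assumes "a \<oplus> b = \<zero>" "a \<in> carrier S" "b \<in> carrier S"
  shows "a = \<zero>"
proof -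
  have "a \<in> Units (add_monoid S)"
    using assms a_comm[of a b] by (auto simp: Units_def)
  then show ?thesis by (simp add: add_Units)
qed

text \<open>Split off \<open>f a\<close>: the remaining sum is an additive inverse of it, and only
  \<open>\<zero>\<close> is additively invertible.\<close>

lemma finsum_eq_zeroD:
  assumes "finsum S f A = \<zero>" "finite A" "f \<in> A \<rightarrow> carrier S" "a \<in> A"
  shows "f a = \<zero>"
proof -
  have "f \<in> A - {a} \<rightarrow> carrier S"
    using assms by auto
  then show ?thesis
    using assms finsum_remove[of A a f] add_eq_zeroD[of "f a" "finsum S f (A - {a})"] by auto
qed

text \<open>Cancel the common sum over the other indices. This extracts a single matrix entry from
  an equation between products.\<close>

lemma finsum_cancel:
  assumes "finsum S f A = finsum S g A" "finite A" "a \<in> A"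
    and "f \<in> A \<rightarrow> carrier S" "g \<in> A \<rightarrow> carrier S"
    and eq: "\<And>k. k \<in> A \<Longrightarrow> k \<noteq> a \<Longrightarrow> f k = g k"
  shows "f a = g a"
proof -
  have "finsum S f (A - {a}) = finsum S g (A - {a})"
    using assms by (intro finsum_cong') auto
  then have "f a \<oplus> finsum S g (A - {a}) = g a \<oplus> finsum S g (A - {a})"
    using assms finsum_remove[of A a f] finsum_remove[of A a g] by simp
  moreover have "f a \<in> carrier S" "g a \<in> carrier S" "finsum S g (A - {a}) \<in> carrier S"
    using assms(3-5) by (auto intro!: finsum_closed)
  ultimately show ?thesis
    by (rule add_r_cancel)
qed

text \<open>Back substitution without subtraction: in entry \<open>(i, j)\<close> of the two
  products all terms but one are already known to agree, and in the exceptional term the common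
  factor is a diagonal entry \<open>\<one>\<close>.\<close>

lemma unitriangular_monoid_cancel: "monoid_cancel (unitriangular_monoid S n)"
proof -
  let ?U = "unitriangular_monoid S n"
  interpret U: monoid ?U by (rule unitriangular_monoid)
  show ?thesis
  proof (rule U.monoid_cancelI)
    fix B C A
    assume eq: "A \<otimes>\<^bsub>?U\<^esub> B = A \<otimes>\<^bsub>?U\<^esub> C"
      and B: "B \<in> carrier ?U" and C: "C \<in> carrier ?U" and A: "A \<in> carrier ?U"
    note ABC = unitriangularD[OF A] unitriangularD[OF B] unitriangularD[OF C]
    have entry: "B $$ (i, j) = C $$ (i, j)" if "i < n" "j < n" for i j
      using that
    \<comment> \<open>Rows are compared from the last one upwards: terms with \<open>k < i\<close>
      vanish because \<open>A\<close> is triangular, and rows \<open>k > i\<close> are covered by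
      the induction hypothesis.\<close>
    proof (induction "n - i" arbitrary: i rule: less_induct)
      case less
      have "A $$ (i, i) \<otimes> B $$ (i, j) = A $$ (i, i) \<otimes> C $$ (i, j)"
      proof (rule finsum_cancel[where A = "{..<n}" and f = "\<lambda>k. A $$ (i, k) \<otimes> B $$ (k, j)"
            and g = "\<lambda>k. A $$ (i, k) \<otimes> C $$ (k, j)"])
        show "(\<Oplus>k\<in>{..<n}. A $$ (i, k) \<otimes> B $$ (k, j)) = (\<Oplus>k\<in>{..<n}. A $$ (i, k) \<otimes> C $$ (k, j))"
          using arg_cong[OF eq, of "\<lambda>M. M $$ (i, j)"] less.prems
          by (simp add: unitriangular_mult_index)
        fix k assume k: "k \<in> {..<n}" "k \<noteq> i"
        show "A $$ (i, k) \<otimes> B $$ (k, j) = A $$ (i, k) \<otimes> C $$ (k, j)"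
        proof (cases "k < i")
          case True
          with k less.prems show ?thesis by (simp add: ABC)
        next
          case False
          with k less show ?thesis by simp
        qed
      qed (use less.prems in \<open>auto simp: ABC\<close>)
      with less.prems show ?case by (simp add: ABC)
    qed
    show "B = C"
      by (rule eq_matI) (simp_all add: ABC entry)
  next
    fix B C A
    assume eq: "B \<otimes>\<^bsub>?U\<^esub> A = C \<otimes>\<^bsub>?U\<^esub> A"
      and B: "B \<in> carrier ?U" and C: "C \<in> carrier ?U" and A: "A \<in> carrier ?U"
    note ABC = unitriangularD[OF A] unitriangularD[OF B] unitriangularD[OF C]
    have entry: "B $$ (i, j) = C $$ (i, j)" if "i < n" "j < n" for i j
      using that
    \<comment> \<open>For cancellation on the right, columns are compared from left to right; terms
      with \<open>k > j\<close> vanish.\<close>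
    proof (induction j rule: less_induct)
      case (less j)
      have "B $$ (i, j) \<otimes> A $$ (j, j) = C $$ (i, j) \<otimes> A $$ (j, j)"
      proof (rule finsum_cancel[where A = "{..<n}" and f = "\<lambda>k. B $$ (i, k) \<otimes> A $$ (k, j)"
            and g = "\<lambda>k. C $$ (i, k) \<otimes> A $$ (k, j)"])
        show "(\<Oplus>k\<in>{..<n}. B $$ (i, k) \<otimes> A $$ (k, j)) = (\<Oplus>k\<in>{..<n}. C $$ (i, k) \<otimes> A $$ (k, j))"
          using arg_cong[OF eq, of "\<lambda>M. M $$ (i, j)"] less.prems
          by (simp add: unitriangular_mult_index)
        fix k assume k: "k \<in> {..<n}" "k \<noteq> j"
        show "B $$ (i, k) \<otimes> A $$ (k, j) = C $$ (i, k) \<otimes> A $$ (k, j)"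
        proof (cases "k < j")
          case True
          with k less show ?thesis by simp
        next
          case False
          with k less.prems show ?thesis by (simp add: ABC)
        qed
      qed (use less.prems in \<open>auto simp: ABC\<close>)
      with less.prems show ?case by (simp add: ABC)
    qed
    show "B = C"
      by (rule eq_matI) (simp_all add: ABC entry)
  qed
qed

text \<open>Above the diagonal the entries of \<open>A \<otimes> B = \<one>\<close> are sums equal
  to \<open>\<zero>\<close>, so each of their terms is \<open>\<zero>\<close>.\<close>

lemma unitriangular_Units: "Units (unitriangular_monoid S n) = {\<one>\<^bsub>unitriangular_monoid S n\<^esub>}"
proof -
  let ?U = "unitriangular_monoid S n"
  interpret U: monoid ?U by (rule unitriangular_monoid)
  have "A = \<one>\<^bsub>?U\<^esub>" if "A \<in> Units ?U" for A
  proof -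
    from that obtain B where A: "A \<in> carrier ?U" and B: "B \<in> carrier ?U"
      and AB: "A \<otimes>\<^bsub>?U\<^esub> B = \<one>\<^bsub>?U\<^esub>"
      by (auto simp: Units_def)
    note A = unitriangularD[OF A] and B = unitriangularD[OF B]
    have upper: "A $$ (i, j) = \<zero>" if ij: "i < j" "j < n" for i j
    proof -
      have "(\<Oplus>k\<in>{..<n}. A $$ (i, k) \<otimes> B $$ (k, j)) = \<zero>"
        using ij AB unitriangular_mult_index[of i n j S A B]
        by (simp add: unitriangular_one_index)
      \<comment> \<open>The term \<open>k = j\<close> is chosen because
        \<open>B $$ (j, j) = \<one>\<close>, so it is just \<open>A $$ (i, j)\<close>.\<close>
      then have "A $$ (i, j) \<otimes> B $$ (j, j) = \<zero>"
        by (rule finsum_eq_zeroD) (use ij in \<open>auto simp: A B\<close>)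
      with ij show ?thesis by (simp add: A B)
    qed
    show ?thesis
    proof (rule eq_matI)
      fix i j assume "i < dim_row \<one>\<^bsub>?U\<^esub>" "j < dim_col \<one>\<^bsub>?U\<^esub>"
      then show "A $$ (i, j) = \<one>\<^bsub>?U\<^esub> $$ (i, j)"
        by (cases i j rule: linorder_cases)
          (simp_all add: unitriangular_one_dim unitriangular_one_index A upper)
    qed (simp_all add: A unitriangular_one_dim)
  qed
  then show ?thesis by auto
qed

section \<open>From length functions on \<open>(S, +)\<close> to length functions on U_n(S)\<close>

lemma length_function_finsum:
  assumes f: "length_function (add_monoid S) f" and "finite A" "g \<in> A \<rightarrow> carrier S"
  shows "(\<Sum>k\<in>A. f (g k)) \<le> f (finsum S g A)"
  using assms(2,3)
proof (induction A)
  case (insert a A)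
  then show ?case
    using length_function_mult_le[OF f, of "g a" "finsum S g A"] by (auto simp: Pi_iff)
qed simp

text \<open>Superadditivity is checked position by position. If the total is 0, then every entry
  above the diagonal is an additive unit, hence \<open>\<zero>\<close>, and the matrix is the
  identity.\<close>

lemma unitriangular_length_function:
  assumes f: "length_function (add_monoid S) f"
  shows "length_function (unitriangular_monoid S n) (\<lambda>A. \<Sum>j<n. \<Sum>i<j. f (A $$ (i, j)))"
proof (rule length_functionI)
  let ?U = "unitriangular_monoid S n"
  fix A B assume A: "A \<in> carrier ?U" and B: "B \<in> carrier ?U"
  note AB = unitriangularD[OF A] unitriangularD[OF B]
  have "f (A $$ (i, j)) + f (B $$ (i, j)) \<le> f ((A \<otimes>\<^bsub>?U\<^esub> B) $$ (i, j))"
    if ij: "i < j" "j < n" for i j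
  proof -
    let ?g = "\<lambda>k. A $$ (i, k) \<otimes> B $$ (k, j)"
    \<comment> \<open>The diagonal entries are \<open>\<one>\<close>, so \<open>?g i\<close> is the
      entry of \<open>B\<close> and \<open>?g j\<close> that of \<open>A\<close>; these are two
      separate terms because \<open>i < j\<close>.\<close>
    have "f (A $$ (i, j)) + f (B $$ (i, j)) = (\<Sum>k\<in>{i, j}. f (?g k))"
      using ij by (simp add: AB)
    also have "\<dots> \<le> (\<Sum>k<n. f (?g k))"
      using ij by (intro sum_mono2) auto
    also have "\<dots> \<le> f (\<Oplus>k\<in>{..<n}. ?g k)"
      by (rule length_function_finsum[OF f]) (use ij in \<open>auto simp: AB\<close>)
    also have "(\<Oplus>k\<in>{..<n}. ?g k) = (A \<otimes>\<^bsub>?U\<^esub> B) $$ (i, j)"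
      using ij by (simp add: unitriangular_mult_index)
    finally show ?thesis .
  qed
  then show "(\<Sum>j<n. \<Sum>i<j. f (A $$ (i, j))) + (\<Sum>j<n. \<Sum>i<j. f (B $$ (i, j)))
      \<le> (\<Sum>j<n. \<Sum>i<j. f ((A \<otimes>\<^bsub>?U\<^esub> B) $$ (i, j)))"
    unfolding sum.distrib[symmetric] by (intro sum_mono) auto
next
  let ?U = "unitriangular_monoid S n"
  fix A assume "A \<in> carrier ?U" and 0: "(\<Sum>j<n. \<Sum>i<j. f (A $$ (i, j))) = 0"
  note A = unitriangularD[OF \<open>A \<in> carrier ?U\<close>]
  have upper: "A $$ (i, j) = \<zero>" if "i < j" "j < n" for i j
    using 0 that length_function_eq_0_imp_Units[OF f, of "A $$ (i, j)"] by (simp add: A add_Units)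
  have "A = \<one>\<^bsub>?U\<^esub>"
  proof (rule eq_matI)
    fix i j assume "i < dim_row \<one>\<^bsub>?U\<^esub>" "j < dim_col \<one>\<^bsub>?U\<^esub>"
    then show "A $$ (i, j) = \<one>\<^bsub>?U\<^esub> $$ (i, j)"
      by (cases i j rule: linorder_cases)
        (simp_all add: unitriangular_one_dim unitriangular_one_index A upper)
  qed (simp_all add: A unitriangular_one_dim)
  then show "A \<in> Units ?U" by (simp add: unitriangular_Units)
qed

section \<open>The embedding of \<open>(S, +)\<close> into U_n(S)\<close>

definition transvection :: "nat \<Rightarrow> 'a \<Rightarrow> 'a mat" where
  "transvection n x = mat n n (\<lambda>(i, j). if i = j then \<one> else if i = 0 \<and> j = 1 then x else \<zero>)"

lemma transvection_closed:
  "x \<in> carrier S \<Longrightarrow> transvection n x \<in> carrier (unitriangular_monoid S n)"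
  by (auto simp: carrier_unitriangular_iff transvection_def)

text \<open>The matrix unit at position \<open>(0, 1)\<close> squares to zero, so the product of two
  transvections has no mixed term.\<close>

lemma transvection_add:
  assumes x: "x \<in> carrier S" and y: "y \<in> carrier S"
  shows "transvection n (x \<oplus> y) = transvection n x \<otimes>\<^bsub>unitriangular_monoid S n\<^esub> transvection n y"
    (is "_ = ?X \<otimes>\<^bsub>?U\<^esub> ?Y")
proof (rule eq_matI)
  fix i j assume "i < dim_row (?X \<otimes>\<^bsub>?U\<^esub> ?Y)" "j < dim_col (?X \<otimes>\<^bsub>?U\<^esub> ?Y)"
  then have ij: "i < n" "j < n" by (simp_all add: unitriangular_mult_dim)
  let ?g = "\<lambda>k. ?X $$ (i, k) \<otimes> ?Y $$ (k, j)"
  have closed: "?g \<in> {..<n} \<rightarrow> carrier S"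
    using ij x y by (auto simp: transvection_def)
  \<comment> \<open>Off its diagonal \<open>?X\<close> can be nonzero only at \<open>(0, 1)\<close>,
    and row 1 of \<open>?Y\<close> agrees with that of the identity. The term \<open>k = i\<close>
    split off below is \<open>?Y $$ (i, j)\<close>.\<close>
  have "(\<Oplus>k\<in>{..<n} - {i}. ?g k) = (if i = 0 \<and> j = 1 then x else \<zero>)"
  proof (cases "i = 0 \<and> j = 1")
    case True
    then have "(\<Oplus>k\<in>{..<n} - {i}. ?g k) = ?g 1"
      using ij x y by (intro finsum_single) (auto simp: transvection_def)
    with True ij x show ?thesis by (simp add: transvection_def)
  next
    case False
    have "(\<Oplus>k\<in>{..<n} - {i}. ?g k) = \<zero>"
      using ij x y False by (intro add.finprod_one_eqI) (auto simp: transvection_def)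
    with False show ?thesis by auto
  qed
  moreover have "(?X \<otimes>\<^bsub>?U\<^esub> ?Y) $$ (i, j) = ?g i \<oplus> (\<Oplus>k\<in>{..<n} - {i}. ?g k)"
    using ij closed by (simp add: unitriangular_mult_index finsum_remove)
  ultimately show "transvection n (x \<oplus> y) $$ (i, j) = (?X \<otimes>\<^bsub>?U\<^esub> ?Y) $$ (i, j)"
    using ij x y by (auto simp: transvection_def a_comm)
qed (simp_all add: unitriangular_mult_dim transvection_def)

text \<open>Superadditivity passes along the homomorphism \<open>transvection n\<close>. The
  condition on zeros needs its injectivity, which holds because \<open>n \<ge> 2\<close>: for
  smaller \<open>n\<close> there is no position \<open>(0, 1)\<close> and every transvection is the
  identity.\<close>

lemma transvection_length_function:
  assumes f: "length_function (unitriangular_monoid S n) f" and n: "n \<ge> 2"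
  shows "length_function (add_monoid S) (\<lambda>x. f (transvection n x))"
proof (rule length_functionI)
  fix x assume "x \<in> carrier (add_monoid S)" and "f (transvection n x) = 0"
  then have "transvection n x = \<one>\<^bsub>unitriangular_monoid S n\<^esub>"
    using length_function_eq_0_imp_Units[OF f] transvection_closed unitriangular_Units by auto
  then have "transvection n x $$ (0, 1) = \<one>\<^bsub>unitriangular_monoid S n\<^esub> $$ (0, 1)"
    by simp
  with n show "x \<in> Units (add_monoid S)"
    by (simp add: transvection_def unitriangular_one_index add_Units)
qed (simp add: transvection_add transvection_closed length_function_mult_le[OF f])

section \<open>Transfer of the BFM property in both directions\<close>

lemma bf_monoid_unitriangular:
  assumes "bf_monoid (add_monoid S)"
  shows "bf_monoid (unitriangular_monoid S n)"
proof -
  obtain f where "length_function (add_monoid S) f"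
    using bf_monoid.ex_length_function[OF assms] add_Units by auto
  then show ?thesis
    using monoid_cancel.length_function_imp_bf_monoid[OF unitriangular_monoid_cancel]
      unitriangular_length_function by blast
qed

lemma bf_monoid_add:
  assumes "bf_monoid (unitriangular_monoid S n)" "n \<ge> 2"
  shows "bf_monoid (add_monoid S)"
proof -
  obtain f where "length_function (unitriangular_monoid S n) f"
    using bf_monoid.ex_length_function[OF assms(1) unitriangular_Units] by blast
  from transvection_length_function[OF this assms(2)] show ?thesis
    by (rule monoid_cancel.length_function_imp_bf_monoid[OF comm_monoid_cancel.axioms(1)[OF add_cancel]])
qed

end

theorem theorem4p10:
  fixes S (structure)
  assumes "reduced_information_semialgebra S"
  shows "((\<forall>n::nat. n \<ge> 2 \<longrightarrow> bf_monoid (unitriangular_monoid S n)) \<longleftrightarrow>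
          (\<exists>n::nat. n \<ge> 2 \<and> bf_monoid (unitriangular_monoid S n))) \<and>
         ((\<exists>n::nat. n \<ge> 2 \<and> bf_monoid (unitriangular_monoid S n)) \<longleftrightarrow>
          bf_monoid (add_monoid S))"
proof -
  interpret reduced_information_semialgebra S by fact
  \<comment> \<open>The first fact gives (c) implies (a), the second (b) implies (c); (a) implies
    (b) because some integer is at least 2.\<close>
  show ?thesis
    using bf_monoid_unitriangular bf_monoid_add by blast
qed

end
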